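(* Let $A^{(1)},\dots,A^{(K)}\in\mathbb{R}^{n\times n}$ be symmetric matrices, let $\boldsymbol{p}_k=[\underline{p}_k,\overline{p}_k]$, $k=1,\dots,K$, be compact real intervals, and let $\boldsymbol{p}=\boldsymbol{p}_1\times\dots\times\boldsymbol{p}_K$. For $p\in\mathbb{R}^K$ let $A(p)=\sum_{k=1}^K A^{(k)}p_k$. For each $k=1,\dots,K$, let $A^{(k)}=A^{(k)}_1-A^{(k)}_2$, where both $A^{(k)}_1,A^{(k)}_2\in\mathbb{R}^{n\times n}$ are positive semidefinite. If the matrix $$\sum_{k=1}^K\left(A^{(k)}_1\underline{p}_k-A^{(k)}_2\overline{p}_k\right)$$ is positive semidefinite, then the parametric matrix $A(p)$, $p\in\boldsymbol{p}$, is strongly positive semidefinite.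
   Context: The parametric matrix $A(p)$, $p\in\boldsymbol{p}$, is called strongly positive semidefinite if $A(p)$ is positive semidefinite for each $p\in\boldsymbol{p}$. Intervals satisfy $\underline{p}_k\le\overline{p}_k$. Positive semidefinite refers to real symmetric matrices. *)

theory Defs
  imports "HOL-Analysis.Analysis"
begin

definition symmetric_matrix :: "real^'n^'n \<Rightarrow> bool" where
  "symmetric_matrix M \<longleftrightarrow> transpose M = M"

definition positive_semidefinite :: "real^'n^'n \<Rightarrow> bool" where
  "positive_semidefinite M \<longleftrightarrow> symmetric_matrix M \<and> (\<forall>x. 0 \<le> x \<bullet> (M *v x))"

definition parametric_matrix :: "('k::finite \<Rightarrow> real^'n^'n) \<Rightarrow> real^'k \<Rightarrow> real^'n^'n" where
  "parametric_matrix A p = (\<Sum>k\<in>UNIV. (p $ k) *\<^sub>R A k)"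

definition strongly_positive_semidefinite ::
    "(real^'k \<Rightarrow> real^'n^'n) \<Rightarrow> (real^'k) set \<Rightarrow> bool" where
  "strongly_positive_semidefinite M P \<longleftrightarrow> (\<forall>p\<in>P. positive_semidefinite (M p))"

end

theory Submission
  imports Defs
begin

text \<open>
  The positive semidefinite matrices form a convex cone: they are closed under sums and under
  multiplication by nonnegative scalars. For a parameter \<open>p\<close> in the box, the matrix \<open>A(p)\<close> differs
  from the matrix assumed positive semidefinite by
  \[ \sum_k \bigl((p_k - \underline{p}_k) A^{(k)}_1 + (\overline{p}_k - p_k) A^{(k)}_2\bigr), \]
  and both coefficients are nonnegative precisely because \<open>p\<close> lies in the box. Hence \<open>A(p)\<close> is a
  sum of elements of the cone. The assumed matrix is thus a lower bound, in the Loewner order,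
  of all \<open>A(p)\<close>: it evaluates each semidefinite part at its worst endpoint.
\<close>

lemma positive_semidefinite_zero: "positive_semidefinite 0"
  by (simp add: positive_semidefinite_def symmetric_matrix_def transpose_def vec_eq_iff)

lemma positive_semidefinite_add:
  assumes "positive_semidefinite M" and "positive_semidefinite N"
  shows "positive_semidefinite (M + N)"
  using assms
  by (simp add: positive_semidefinite_def symmetric_matrix_def transpose_def vec_eq_iff
      matrix_vector_mult_add_rdistrib inner_add_right)

lemma positive_semidefinite_scaleR:
  assumes "positive_semidefinite M" and "0 \<le> c"
  shows "positive_semidefinite (c *\<^sub>R M)"
  using assms
  by (simp add: positive_semidefinite_def symmetric_matrix_def transpose_def vec_eq_iff
      scaleR_matrix_vector_assoc [symmetric])

lemma positive_semidefinite_sum: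
  assumes "\<And>i. i \<in> S \<Longrightarrow> positive_semidefinite (M i)"
  shows "positive_semidefinite (\<Sum>i\<in>S. M i)"
  using assms
  by (induction S rule: infinite_finite_induct)
    (auto intro: positive_semidefinite_zero positive_semidefinite_add)

theorem theorem5:
  fixes A A1 A2 :: "'k::finite \<Rightarrow> real^'n^'n"
    and pl pu :: "real^'k"
  assumes "\<And>k. symmetric_matrix (A k)"
    and "\<And>k. pl $ k \<le> pu $ k"
    and "\<And>k. A k = A1 k - A2 k"
    and "\<And>k. positive_semidefinite (A1 k)"
    and "\<And>k. positive_semidefinite (A2 k)"
    and "positive_semidefinite (\<Sum>k\<in>UNIV. (pl $ k) *\<^sub>R A1 k - (pu $ k) *\<^sub>R A2 k)"
  shows "strongly_positive_semidefinite (parametric_matrix A) (cbox pl pu)"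
  unfolding strongly_positive_semidefinite_def
proof
  fix p assume "p \<in> cbox pl pu"
  then have bounds: "pl $ k \<le> p $ k" "p $ k \<le> pu $ k" for k
    by (auto simp: mem_box_cart)
  have "parametric_matrix A p =
      (\<Sum>k\<in>UNIV. (pl $ k) *\<^sub>R A1 k - (pu $ k) *\<^sub>R A2 k) +
      (\<Sum>k\<in>UNIV. (p $ k - pl $ k) *\<^sub>R A1 k + (pu $ k - p $ k) *\<^sub>R A2 k)"
    unfolding parametric_matrix_def sum.distrib [symmetric]
    by (rule sum.cong) (simp_all add: assms(3) algebra_simps)
  moreover have "positive_semidefinite
      (\<Sum>k\<in>UNIV. (p $ k - pl $ k) *\<^sub>R A1 k + (pu $ k - p $ k) *\<^sub>R A2 k)"
    using assms(4,5) bounds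
    by (intro positive_semidefinite_sum positive_semidefinite_add positive_semidefinite_scaleR)
      simp_all
  ultimately show "positive_semidefinite (parametric_matrix A p)"
    using assms(6) by (simp only: positive_semidefinite_add)
qed

end
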